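(* Let $q:\Theta\to Y$, $g:Y\to X$ and $f:X\to Y$ be even morphisms in a quantum Markov category, set $p:=g\circ q$, and suppose that $g$ is a left disintegration of $(f,p,q)$, i.e. $((f g)\otimes\mathrm{id}_Y)\Delta_Yq=\Delta_Yq$. Then $g$ is left $q$-a.e. modular with respect to $f$, i.e. $$(\mathrm{id}_X\otimes f\otimes\mathrm{id}_Y)\big((\Delta_Xg)\otimes\mathrm{id}_Y\big)\Delta_Yq=(g\otimes\mathrm{id}_Y\otimes\mathrm{id}_Y)(\Delta_Y\otimes\mathrm{id}_Y)\Delta_Yq,$$ if and only if both of the following equalities hold: (a) $(g\otimes\mathrm{id}_Y)\Delta_Yq=(\mathrm{id}_X\otimes f)\Delta_Xp$; (b) $(\mathrm{id}_X\otimes f\otimes f)(\mathrm{id}_X\otimes\Delta_X)\Delta_Xp=(\mathrm{id}_X\otimes(\Delta_Yf))\Delta_Xp$. In words: an even subcategory $\mathcal{C}$ of a quantum Markov category is left a.e. modular if and only if for every left disintegration $g$ of $(f,p,q)$ in $\mathcal{C}$, $g$ is a left Bayesian inverse of $(f,p,q)$ and $f$ is right $p$-a.e. deterministic.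
   Context: A $\mathbb{Z}_2$-monoidal category is a category in which every morphism has a grade in $\mathbb{Z}_2=\{0,1\}$ ($0$ = even, $1$ = odd), identities being even and grades adding under composition, such that for each object $X$ and each grade there is an isomorphism with source $X$ of that grade; together with a tensor product assigning $X\otimes Y$ to objects and $f\otimes f'$ (of the common grade) to pairs of morphisms of equal grade, functorially; a unit object $I$ with a chosen odd involution $*_I$ of $I$; and even natural isomorphisms (associator, symmetry $c_{X,Y}:X\otimes Y\to Y\otimes X$, unitor $I\otimes X\to X$) satisfying the usual axioms of a symmetric monoidal category. Associators and unitors are suppressed. A quantum CD category is a $\mathbb{Z}_2$-monoidal category with, for each object $X$, even morphisms $\Delta_X:X\to X\otimes X$, $!_X:X\to I$ and an odd morphism $*_X:X\to X$ such that: $(!_X\otimes\mathrm{id})\Delta_X=\mathrm{id}_X=(\mathrm{id}\otimes{!_X})\Delta_X$; $(\Delta_X\otimes\mathrm{id})\Delta_X=(\mathrm{id}\otimes\Delta_X)\Delta_X$; $c_{X,X}( *_X\otimes*_X)\Delta_X=\Delta_X*_X$; $!_{X\otimes Y}={!_X}\otimes{!_Y}$; $!_I=\mathrm{id}_I$; $\Delta_{X\otimes Y}=(\mathrm{id}_X\otimes c_{X,Y}\otimes\mathrm{id}_Y)(\Delta_X\otimes\Delta_Y)$; $\Delta_I=\mathrm{id}_I$; $*_X*_X=\mathrm{id}_X$; $*_{X\otimes Y}=*_X\otimes*_Y$; $!_X*_X=*_I\,!_X$. It is a quantum Markov category if moreover every even $f:X\to Y$ satisfies $!_Y f={!_X}$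 and every odd $f:X\to Y$ satisfies $!_Yf={!_X}*_X$. An even subcategory is a subcategory all of whose morphisms are even. Here $p:\Theta\to X$, $q:\Theta\to Y$ are arbitrary morphisms (not necessarily states, i.e. $\Theta$ need not be $I$) with $fp=q$. A left disintegration of $(f,p,q)$ in $\mathcal{C}$ is a morphism $g:Y\to X$ in $\mathcal{C}$ with $gq=p$ and $((fg)\otimes\mathrm{id}_Y)\Delta_Yq=\Delta_Yq$ (with $f,p,q$ in $\mathcal{C}$). A left Bayesian inverse of $(f,p,q)$ is a $g:Y\to X$ in $\mathcal{C}$ satisfying (a). $f$ is right $p$-a.e. deterministic if (b) holds. $\mathcal{C}$ is left a.e. modular if for all $f:X\to Y$, $g:Y\to X$, $q:\Theta\to Y$ in $\mathcal{C}$ with $((fg)\otimes\mathrm{id}_Y)\Delta_Yq=\Delta_Yq$, $g$ is left $q$-a.e. modular with respect to $f$ (the displayed equality in the claim). *)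

theory Defs
  imports Main "HOL-Library.Z2"
begin

text \<open>
  Grades live in the two-element field \<^typ>\<open>bit\<close>, with 0 for even and 1 for odd.
  The values of the structure maps outside the carriers \<open>Obj\<close> and \<open>Arr\<close>, on non-composable
  pairs, and of the tensor product on pairs of morphisms of different grades are unconstrained.
\<close>

record ('o, 'a) z2_cat =
  Obj :: "'o set"
  Arr :: "'a set"
  Dom :: "'a \<Rightarrow> 'o"
  Cod :: "'a \<Rightarrow> 'o"
  ident :: "'o \<Rightarrow> 'a"  ("idm\<index>")
  comp :: "'a \<Rightarrow> 'a \<Rightarrow> 'a"  (infixr "\<cdot>\<index>" 55)
  grade :: "'a \<Rightarrow> bit"

definition hom :: "('o, 'a, 'm) z2_cat_scheme \<Rightarrow> 'o \<Rightarrow> 'o \<Rightarrow> 'a set"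
  where "hom C X Y = {f \<in> Arr C. Dom C f = X \<and> Cod C f = Y}"

definition is_even :: "('o, 'a, 'm) z2_cat_scheme \<Rightarrow> 'a \<Rightarrow> bool"
  where "is_even C f \<longleftrightarrow> grade C f = 0"

definition is_odd :: "('o, 'a, 'm) z2_cat_scheme \<Rightarrow> 'a \<Rightarrow> bool"
  where "is_odd C f \<longleftrightarrow> grade C f = 1"

definition inverse_arrows :: "('o, 'a, 'm) z2_cat_scheme \<Rightarrow> 'a \<Rightarrow> 'a \<Rightarrow> bool"
  where "inverse_arrows C f g \<longleftrightarrow>
    f \<in> Arr C \<and> g \<in> hom C (Cod C f) (Dom C f) \<and>
    g \<cdot> f = idm (Dom C f) \<and> f \<cdot> g = idm (Cod C f)"
  for C (structure)

definition is_iso :: "('o, 'a, 'm) z2_cat_scheme \<Rightarrow> 'a \<Rightarrow> bool"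
  where "is_iso C f \<longleftrightarrow> (\<exists>g. inverse_arrows C f g)"

definition inv_arr :: "('o, 'a, 'm) z2_cat_scheme \<Rightarrow> 'a \<Rightarrow> 'a"
  where "inv_arr C f = (THE g. inverse_arrows C f g)"

locale z2_category =
  fixes C :: "('o, 'a, 'm) z2_cat_scheme" (structure)
  assumes Dom_in: "f \<in> Arr C \<Longrightarrow> Dom C f \<in> Obj C"
    and Cod_in: "f \<in> Arr C \<Longrightarrow> Cod C f \<in> Obj C"
    and ident_in: "X \<in> Obj C \<Longrightarrow> idm X \<in> hom C X X"
    and comp_in: "f \<in> hom C X Y \<Longrightarrow> g \<in> hom C Y Z \<Longrightarrow> g \<cdot> f \<in> hom C X Z"
    and ident_comp: "f \<in> hom C X Y \<Longrightarrow> idm Y \<cdot> f = f"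
    and comp_ident: "f \<in> hom C X Y \<Longrightarrow> f \<cdot> idm X = f"
    and comp_assoc: "f \<in> hom C W X \<Longrightarrow> g \<in> hom C X Y \<Longrightarrow> h \<in> hom C Y Z \<Longrightarrow>
      (h \<cdot> g) \<cdot> f = h \<cdot> (g \<cdot> f)"
    and grade_ident: "X \<in> Obj C \<Longrightarrow> grade C (idm X) = 0"
    and grade_comp: "f \<in> hom C X Y \<Longrightarrow> g \<in> hom C Y Z \<Longrightarrow>
      grade C (g \<cdot> f) = grade C g + grade C f"
    and iso_of_grade: "X \<in> Obj C \<Longrightarrow>
      \<exists>f \<in> Arr C. Dom C f = X \<and> is_iso C f \<and> grade C f = d"

record ('o, 'a) z2_moncat = "('o, 'a) z2_cat" +
  tensor_obj :: "'o \<Rightarrow> 'o \<Rightarrow> 'o"  (infixr "\<odot>\<index>" 70)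
  tensor :: "'a \<Rightarrow> 'a \<Rightarrow> 'a"  (infixr "\<otimes>\<index>" 70)
  unit :: "'o"  ("\<I>\<index>")
  unit_star :: "'a"
  assoc :: "'o \<Rightarrow> 'o \<Rightarrow> 'o \<Rightarrow> 'a"  ("\<alpha>\<index>")
  symm :: "'o \<Rightarrow> 'o \<Rightarrow> 'a"  ("\<c>\<index>")
  lunitor :: "'o \<Rightarrow> 'a"  ("\<lambda>I\<index>")

definition runitor :: "('o, 'a, 'm) z2_moncat_scheme \<Rightarrow> 'o \<Rightarrow> 'a"  ("\<rho>I\<index>")
  where "\<rho>I X = \<lambda>I X \<cdot> \<c> X \<I>" for C (structure)

text \<open>
  The unit is a graded functor from the one-object category \<open>B\<int>\<^sub>2\<close>, picking out \<open>\<I>\<close> and its odd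
  involution.  Hence the unitor is natural for odd morphisms in the sense that \<open>\<I>\<close> is acted on
  by \<open>unit_star\<close> (the tensor product of \<open>idm \<I>\<close> with an odd morphism is meaningless).
  The usual symmetric monoidal axioms are given for the left unitor, with the right unitor
  obtained from it through the symmetry.
\<close>

locale z2_monoidal_category = z2_category C
  for C :: "('o, 'a, 'm) z2_moncat_scheme" (structure) +
  assumes tensor_obj_in: "X \<in> Obj C \<Longrightarrow> Y \<in> Obj C \<Longrightarrow> X \<odot> Y \<in> Obj C"
    and tensor_in: "f \<in> hom C X Y \<Longrightarrow> f' \<in> hom C X' Y' \<Longrightarrow> grade C f = grade C f' \<Longrightarrow>
      f \<otimes> f' \<in> hom C (X \<odot> X') (Y \<odot> Y')"
    and grade_tensor: "f \<in> Arr C \<Longrightarrow> f' \<in> Arr C \<Longrightarrow> grade C f = grade C f' \<Longrightarrow>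
      grade C (f \<otimes> f') = grade C f"
    and tensor_ident: "X \<in> Obj C \<Longrightarrow> Y \<in> Obj C \<Longrightarrow> idm X \<otimes> idm Y = idm (X \<odot> Y)"
    and tensor_comp: "f \<in> hom C X Y \<Longrightarrow> g \<in> hom C Y Z \<Longrightarrow>
      f' \<in> hom C X' Y' \<Longrightarrow> g' \<in> hom C Y' Z' \<Longrightarrow>
      grade C f = grade C f' \<Longrightarrow> grade C g = grade C g' \<Longrightarrow>
      (g \<cdot> f) \<otimes> (g' \<cdot> f') = (g \<otimes> g') \<cdot> (f \<otimes> f')"
    and unit_in: "\<I> \<in> Obj C"
    and unit_star_in: "unit_star C \<in> hom C \<I> \<I>"
    and unit_star_odd: "is_odd C (unit_star C)"
    and unit_star_invol: "unit_star C \<cdot> unit_star C = idm \<I>"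
    and assoc_in: "X \<in> Obj C \<Longrightarrow> Y \<in> Obj C \<Longrightarrow> Z \<in> Obj C \<Longrightarrow>
      \<alpha> X Y Z \<in> hom C ((X \<odot> Y) \<odot> Z) (X \<odot> (Y \<odot> Z))"
    and assoc_even: "X \<in> Obj C \<Longrightarrow> Y \<in> Obj C \<Longrightarrow> Z \<in> Obj C \<Longrightarrow> is_even C (\<alpha> X Y Z)"
    and assoc_iso: "X \<in> Obj C \<Longrightarrow> Y \<in> Obj C \<Longrightarrow> Z \<in> Obj C \<Longrightarrow> is_iso C (\<alpha> X Y Z)"
    and assoc_natural: "f \<in> hom C X X' \<Longrightarrow> g \<in> hom C Y Y' \<Longrightarrow> h \<in> hom C Z Z' \<Longrightarrow>
      grade C f = grade C g \<Longrightarrow> grade C g = grade C h \<Longrightarrow>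
      \<alpha> X' Y' Z' \<cdot> ((f \<otimes> g) \<otimes> h) = (f \<otimes> (g \<otimes> h)) \<cdot> \<alpha> X Y Z"
    and symm_in: "X \<in> Obj C \<Longrightarrow> Y \<in> Obj C \<Longrightarrow> \<c> X Y \<in> hom C (X \<odot> Y) (Y \<odot> X)"
    and symm_even: "X \<in> Obj C \<Longrightarrow> Y \<in> Obj C \<Longrightarrow> is_even C (\<c> X Y)"
    and symm_natural: "f \<in> hom C X X' \<Longrightarrow> g \<in> hom C Y Y' \<Longrightarrow> grade C f = grade C g \<Longrightarrow>
      \<c> X' Y' \<cdot> (f \<otimes> g) = (g \<otimes> f) \<cdot> \<c> X Y"
    and symm_symm: "X \<in> Obj C \<Longrightarrow> Y \<in> Obj C \<Longrightarrow> \<c> Y X \<cdot> \<c> X Y = idm (X \<odot> Y)"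
    and lunitor_in: "X \<in> Obj C \<Longrightarrow> \<lambda>I X \<in> hom C (\<I> \<odot> X) X"
    and lunitor_even: "X \<in> Obj C \<Longrightarrow> is_even C (\<lambda>I X)"
    and lunitor_iso: "X \<in> Obj C \<Longrightarrow> is_iso C (\<lambda>I X)"
    and lunitor_natural_even: "f \<in> hom C X Y \<Longrightarrow> is_even C f \<Longrightarrow>
      \<lambda>I Y \<cdot> (idm \<I> \<otimes> f) = f \<cdot> \<lambda>I X"
    and lunitor_natural_odd: "f \<in> hom C X Y \<Longrightarrow> is_odd C f \<Longrightarrow>
      \<lambda>I Y \<cdot> (unit_star C \<otimes> f) = f \<cdot> \<lambda>I X"
    and pentagon: "W \<in> Obj C \<Longrightarrow> X \<in> Obj C \<Longrightarrow> Y \<in> Obj C \<Longrightarrow> Z \<in> Obj C \<Longrightarrow>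
      (idm W \<otimes> \<alpha> X Y Z) \<cdot> \<alpha> W (X \<odot> Y) Z \<cdot> (\<alpha> W X Y \<otimes> idm Z)
      = \<alpha> W X (Y \<odot> Z) \<cdot> \<alpha> (W \<odot> X) Y Z"
    and triangle: "X \<in> Obj C \<Longrightarrow> Y \<in> Obj C \<Longrightarrow>
      (idm X \<otimes> \<lambda>I Y) \<cdot> \<alpha> X \<I> Y = \<rho>I X \<otimes> idm Y"
    and hexagon: "X \<in> Obj C \<Longrightarrow> Y \<in> Obj C \<Longrightarrow> Z \<in> Obj C \<Longrightarrow>
      \<alpha> Y Z X \<cdot> \<c> X (Y \<odot> Z) \<cdot> \<alpha> X Y Z
      = (idm Y \<otimes> \<c> X Z) \<cdot> \<alpha> Y X Z \<cdot> (\<c> X Y \<otimes> idm Z)"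

text \<open>
  \<open>mid_swap C X Y\<close> is \<open>idm X \<otimes> \<c> X Y \<otimes> idm Y\<close> as a morphism
  \<open>(X \<odot> X) \<odot> (Y \<odot> Y) \<rightarrow> (X \<odot> Y) \<odot> (X \<odot> Y)\<close>, with the associators made explicit.
\<close>

definition mid_swap :: "('o, 'a, 'm) z2_moncat_scheme \<Rightarrow> 'o \<Rightarrow> 'o \<Rightarrow> 'a"
  where "mid_swap C X Y =
    inv_arr C (\<alpha> X Y (X \<odot> Y)) \<cdot>
    (idm X \<otimes> (\<alpha> Y X Y \<cdot> (\<c> X Y \<otimes> idm Y) \<cdot> inv_arr C (\<alpha> X Y Y))) \<cdot>
    \<alpha> X X (Y \<odot> Y)"
  for C (structure)

record ('o, 'a) qcd_cat = "('o, 'a) z2_moncat" +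
  copy :: "'o \<Rightarrow> 'a"  ("\<Delta>\<index>")
  discard :: "'o \<Rightarrow> 'a"  ("\<^bold>!\<index>")
  star :: "'o \<Rightarrow> 'a"  ("\<star>\<index>")

text \<open>
  Suppressed unitors and associators are inserted.  The equation \<open>discard_star\<close> refers to the
  given involution of the unit object; for \<open>X = \<I>\<close> it forces \<open>\<star> \<I> = unit_star C\<close>.
\<close>

locale quantum_cd_category = z2_monoidal_category C
  for C :: "('o, 'a, 'm) qcd_cat_scheme" (structure) +
  assumes copy_in: "X \<in> Obj C \<Longrightarrow> \<Delta> X \<in> hom C X (X \<odot> X)"
    and copy_even: "X \<in> Obj C \<Longrightarrow> is_even C (\<Delta> X)"
    and discard_in: "X \<in> Obj C \<Longrightarrow> \<^bold>! X \<in> hom C X \<I>"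
    and discard_even: "X \<in> Obj C \<Longrightarrow> is_even C (\<^bold>! X)"
    and star_in: "X \<in> Obj C \<Longrightarrow> \<star> X \<in> hom C X X"
    and star_odd: "X \<in> Obj C \<Longrightarrow> is_odd C (\<star> X)"
    and copy_counit_left: "X \<in> Obj C \<Longrightarrow> \<lambda>I X \<cdot> (\<^bold>! X \<otimes> idm X) \<cdot> \<Delta> X = idm X"
    and copy_counit_right: "X \<in> Obj C \<Longrightarrow> \<rho>I X \<cdot> (idm X \<otimes> \<^bold>! X) \<cdot> \<Delta> X = idm X"
    and copy_coassoc: "X \<in> Obj C \<Longrightarrow>
      \<alpha> X X X \<cdot> (\<Delta> X \<otimes> idm X) \<cdot> \<Delta> X = (idm X \<otimes> \<Delta> X) \<cdot> \<Delta> X"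
    and copy_star: "X \<in> Obj C \<Longrightarrow> \<c> X X \<cdot> (\<star> X \<otimes> \<star> X) \<cdot> \<Delta> X = \<Delta> X \<cdot> \<star> X"
    and discard_tensor: "X \<in> Obj C \<Longrightarrow> Y \<in> Obj C \<Longrightarrow>
      \<^bold>! (X \<odot> Y) = \<lambda>I \<I> \<cdot> (\<^bold>! X \<otimes> \<^bold>! Y)"
    and discard_unit: "\<^bold>! \<I> = idm \<I>"
    and copy_tensor: "X \<in> Obj C \<Longrightarrow> Y \<in> Obj C \<Longrightarrow>
      \<Delta> (X \<odot> Y) = mid_swap C X Y \<cdot> (\<Delta> X \<otimes> \<Delta> Y)"
    and copy_unit: "\<lambda>I \<I> \<cdot> \<Delta> \<I> = idm \<I>"
    and star_star: "X \<in> Obj C \<Longrightarrow> \<star> X \<cdot> \<star> X = idm X"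
    and star_tensor: "X \<in> Obj C \<Longrightarrow> Y \<in> Obj C \<Longrightarrow> \<star> (X \<odot> Y) = \<star> X \<otimes> \<star> Y"
    and discard_star: "X \<in> Obj C \<Longrightarrow> \<^bold>! X \<cdot> \<star> X = unit_star C \<cdot> \<^bold>! X"

locale quantum_markov_category = quantum_cd_category C
  for C :: "('o, 'a, 'm) qcd_cat_scheme" (structure) +
  assumes discard_natural_even: "f \<in> hom C X Y \<Longrightarrow> is_even C f \<Longrightarrow> \<^bold>! Y \<cdot> f = \<^bold>! X"
    and discard_natural_odd: "f \<in> hom C X Y \<Longrightarrow> is_odd C f \<Longrightarrow> \<^bold>! Y \<cdot> f = \<^bold>! X \<cdot> \<star> X"

text \<open>A subcategory is given by its set \<open>U\<close> of objects and its set \<open>S\<close> of morphisms.\<close>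

definition even_subcategory :: "('o, 'a, 'm) z2_cat_scheme \<Rightarrow> 'o set \<Rightarrow> 'a set \<Rightarrow> bool"
  where "even_subcategory C U S \<longleftrightarrow>
    U \<subseteq> Obj C \<and> S \<subseteq> Arr C \<and>
    (\<forall>f\<in>S. Dom C f \<in> U \<and> Cod C f \<in> U) \<and>
    (\<forall>X\<in>U. idm X \<in> S) \<and>
    (\<forall>f\<in>S. \<forall>g\<in>S. Cod C f = Dom C g \<longrightarrow> g \<cdot> f \<in> S) \<and>
    (\<forall>f\<in>S. is_even C f)"
  for C (structure)

text \<open>
  In the following, \<open>S\<close> is the set of morphisms of a subcategory.  The bracketings of threefold
  tensor products are chosen such that both sides have the same codomain without
  inserting associators.
\<close>

definition left_ae_modular ::
    "('o, 'a, 'm) qcd_cat_scheme \<Rightarrow> 'o \<Rightarrow> 'o \<Rightarrow> 'a \<Rightarrow> 'a \<Rightarrow> 'a \<Rightarrow> bool"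
  \<comment> \<open>\<open>g : Y \<rightarrow> X\<close> is left \<open>q\<close>-a.e. modular with respect to \<open>f : X \<rightarrow> Y\<close>\<close>
  where "left_ae_modular C X Y f q g \<longleftrightarrow>
    ((idm X \<otimes> f) \<otimes> idm Y) \<cdot> ((\<Delta> X \<cdot> g) \<otimes> idm Y) \<cdot> \<Delta> Y \<cdot> q
    = ((g \<otimes> idm Y) \<otimes> idm Y) \<cdot> (\<Delta> Y \<otimes> idm Y) \<cdot> \<Delta> Y \<cdot> q"
  for C (structure)

definition right_ae_deterministic ::
    "('o, 'a, 'm) qcd_cat_scheme \<Rightarrow> 'o \<Rightarrow> 'o \<Rightarrow> 'a \<Rightarrow> 'a \<Rightarrow> bool"
  \<comment> \<open>\<open>f : X \<rightarrow> Y\<close> is right \<open>p\<close>-a.e. deterministic\<close>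
  where "right_ae_deterministic C X Y f p \<longleftrightarrow>
    (idm X \<otimes> (f \<otimes> f)) \<cdot> (idm X \<otimes> \<Delta> X) \<cdot> \<Delta> X \<cdot> p
    = (idm X \<otimes> (\<Delta> Y \<cdot> f)) \<cdot> \<Delta> X \<cdot> p"
  for C (structure)

definition triple_in ::
    "('o, 'a, 'm) z2_cat_scheme \<Rightarrow> 'a set \<Rightarrow> 'o \<Rightarrow> 'o \<Rightarrow> 'o \<Rightarrow> 'a \<Rightarrow> 'a \<Rightarrow> 'a \<Rightarrow> bool"
  where "triple_in C S \<Theta> X Y f p q \<longleftrightarrow>
    f \<in> S \<inter> hom C X Y \<and> p \<in> S \<inter> hom C \<Theta> X \<and> q \<in> S \<inter> hom C \<Theta> Y \<and> f \<cdot> p = q"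
  for C (structure)

definition left_disintegration ::
    "('o, 'a, 'm) qcd_cat_scheme \<Rightarrow> 'a set \<Rightarrow> 'o \<Rightarrow> 'o \<Rightarrow> 'o \<Rightarrow> 'a \<Rightarrow> 'a \<Rightarrow> 'a \<Rightarrow> 'a \<Rightarrow> bool"
  where "left_disintegration C S \<Theta> X Y f p q g \<longleftrightarrow>
    triple_in C S \<Theta> X Y f p q \<and> g \<in> S \<inter> hom C Y X \<and> g \<cdot> q = p \<and>
    ((f \<cdot> g) \<otimes> idm Y) \<cdot> \<Delta> Y \<cdot> q = \<Delta> Y \<cdot> q"
  for C (structure)

definition left_Bayesian_inverse ::
    "('o, 'a, 'm) qcd_cat_scheme \<Rightarrow> 'a set \<Rightarrow> 'o \<Rightarrow> 'o \<Rightarrow> 'o \<Rightarrow> 'a \<Rightarrow> 'a \<Rightarrow> 'a \<Rightarrow> 'a \<Rightarrow> bool"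
  where "left_Bayesian_inverse C S \<Theta> X Y f p q g \<longleftrightarrow>
    triple_in C S \<Theta> X Y f p q \<and> g \<in> S \<inter> hom C Y X \<and>
    (g \<otimes> idm Y) \<cdot> \<Delta> Y \<cdot> q = (idm X \<otimes> f) \<cdot> \<Delta> X \<cdot> p"
  for C (structure)

definition left_ae_modular_subcategory ::
    "('o, 'a, 'm) qcd_cat_scheme \<Rightarrow> 'a set \<Rightarrow> bool"
  where "left_ae_modular_subcategory C S \<longleftrightarrow>
    (\<forall>\<Theta> X Y f g q. f \<in> S \<inter> hom C X Y \<longrightarrow> g \<in> S \<inter> hom C Y X \<longrightarrow> q \<in> S \<inter> hom C \<Theta> Y \<longrightarrow>
      ((f \<cdot> g) \<otimes> idm Y) \<cdot> \<Delta> Y \<cdot> q = \<Delta> Y \<cdot> q \<longrightarrow>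
      left_ae_modular C X Y f q g)"
  for C (structure)

end

theory Submission
  imports Defs
begin

text \<open>
  Discarding the last output of the modularity equation gives (a).  Once (a) is known, it turns
  both sides of the modularity equation into the two sides of (b), using coassociativity at \<open>X\<close>
  on the left and at \<open>Y\<close> on the right.  The disintegration property enters only through its
  marginal \<open>f \<cdot> g \<cdot> q = q\<close>, which links the two formulations for subcategories.
\<close>

text \<open>Typing and evenness are bundled into one membership fact, so that one family of
  introduction rules settles the side conditions of composition and of the tensor product together:
  two even morphisms always have equal grades.\<close>

definition even_hom :: "('o, 'a, 'm) z2_cat_scheme \<Rightarrow> 'o \<Rightarrow> 'o \<Rightarrow> 'a set"
  where "even_hom C X Y = {f \<in> hom C X Y. is_even C f}"

section \<open>Typing, associativity and cancellation for even morphisms\<close>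

context z2_category
begin

lemma even_homD:
  assumes "f \<in> even_hom C X Y"
  shows "f \<in> hom C X Y" "is_even C f" "grade C f = 0" "X \<in> Obj C" "Y \<in> Obj C"
  using assms Dom_in Cod_in by (auto simp: even_hom_def hom_def is_even_def)

lemma ident_even_hom: "X \<in> Obj C \<Longrightarrow> idm X \<in> even_hom C X X"
  by (simp add: even_hom_def is_even_def ident_in grade_ident)

lemma comp_even_hom:
  assumes "g \<in> even_hom C Y Z" "f \<in> even_hom C X Y"
  shows "g \<cdot> f \<in> even_hom C X Z"
  using even_homD[OF assms(1)] even_homD[OF assms(2)]
  by (simp add: even_hom_def is_even_def comp_in grade_comp)

lemma even_comp_assoc:
  assumes "h \<in> even_hom C Y Z" "g \<in> even_hom C X Y" "f \<in> even_hom C W X"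
  shows "(h \<cdot> g) \<cdot> f = h \<cdot> (g \<cdot> f)"
  using assms by (meson comp_assoc even_homD(1))

text \<open>Isomorphisms are monic. This later allows equations to be compared after rebracketing by
  an associator.\<close>

lemma is_iso_left_cancel:
  assumes "is_iso C a" and a: "a \<in> hom C Y Z" and f: "f \<in> hom C X Y" and g: "g \<in> hom C X Y"
    and eq: "a \<cdot> f = a \<cdot> g"
  shows "f = g"
proof -
  from assms(1) a obtain b where b: "b \<in> hom C Z Y" "b \<cdot> a = idm Y"
    by (auto simp: is_iso_def inverse_arrows_def hom_def)
  have "f = b \<cdot> (a \<cdot> f)"
    using comp_assoc[OF f a b(1)] b(2) ident_comp[OF f] by simp
  also have "\<dots> = g"
    using comp_assoc[OF g a b(1)] b(2) ident_comp[OF g] eq by simp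
  finally show ?thesis .
qed

end

section \<open>Interchange law and naturality for even morphisms\<close>

context z2_monoidal_category
begin

lemma tensor_even_hom:
  assumes "f \<in> even_hom C X Y" "f' \<in> even_hom C X' Y'"
  shows "f \<otimes> f' \<in> even_hom C (X \<odot> X') (Y \<odot> Y')"
  using even_homD[OF assms(1)] even_homD[OF assms(2)] tensor_in
  by (auto simp: even_hom_def is_even_def hom_def grade_tensor)

lemma assoc_even_hom:
  "X \<in> Obj C \<Longrightarrow> Y \<in> Obj C \<Longrightarrow> Z \<in> Obj C \<Longrightarrow>
    \<alpha> X Y Z \<in> even_hom C ((X \<odot> Y) \<odot> Z) (X \<odot> (Y \<odot> Z))"
  by (simp add: even_hom_def assoc_in assoc_even)

lemma runitor_even_hom: "X \<in> Obj C \<Longrightarrow> \<rho>I X \<in> even_hom C (X \<odot> \<I>) X"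
  unfolding runitor_def
  by (rule comp_even_hom[of _ "\<I> \<odot> X"])
    (simp_all add: even_hom_def lunitor_in lunitor_even symm_in symm_even unit_in)

lemma interchange:
  assumes "g \<in> even_hom C Y Z" "g' \<in> even_hom C Y' Z'"
    and "f \<in> even_hom C X Y" "f' \<in> even_hom C X' Y'"
  shows "(g \<otimes> g') \<cdot> (f \<otimes> f') = (g \<cdot> f) \<otimes> (g' \<cdot> f')"
  using assms by (metis tensor_comp even_homD(1,3))

text \<open>Both composites collapse to \<open>f \<otimes> g\<close> by interchange and the identity
  laws. Used together, the two equations let morphisms acting on different tensor factors change
  order.\<close>

lemma tensor_ident_slide:
  assumes f: "f \<in> even_hom C X Y" and g: "g \<in> even_hom C X' Y'"
  shows "(f \<otimes> idm Y') \<cdot> (idm X \<otimes> g) = f \<otimes> g"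
    and "(idm Y \<otimes> g) \<cdot> (f \<otimes> idm X') = f \<otimes> g"
proof -
  note F = even_homD[OF f] and G = even_homD[OF g]
  show "(f \<otimes> idm Y') \<cdot> (idm X \<otimes> g) = f \<otimes> g"
    using interchange[OF f ident_even_hom[OF G(5)] ident_even_hom[OF F(4)] g]
    by (simp add: comp_ident[OF F(1)] ident_comp[OF G(1)])
  show "(idm Y \<otimes> g) \<cdot> (f \<otimes> idm X') = f \<otimes> g"
    using interchange[OF ident_even_hom[OF F(5)] g f ident_even_hom[OF G(4)]]
    by (simp add: ident_comp[OF F(1)] comp_ident[OF G(1)])
qed

lemma even_assoc_natural:
  assumes "f \<in> even_hom C X X'" "g \<in> even_hom C Y Y'" "h \<in> even_hom C Z Z'"
  shows "\<alpha> X' Y' Z' \<cdot> ((f \<otimes> g) \<otimes> h) = (f \<otimes> (g \<otimes> h)) \<cdot> \<alpha> X Y Z"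
  using assms by (metis assoc_natural even_homD(1,3))

text \<open>Since \<open>\<rho>I\<close> is the left unitor after the symmetry, its naturality
  square is the symmetry square pasted to the left unitor square.\<close>

lemma runitor_natural_even:
  assumes f: "f \<in> even_hom C X Y"
  shows "\<rho>I Y \<cdot> (f \<otimes> idm \<I>) = f \<cdot> \<rho>I X"
proof -
  note F = even_homD[OF f]
  note I = even_homD[OF ident_even_hom[OF unit_in]]
  have cY: "\<c> Y \<I> \<in> hom C (Y \<odot> \<I>) (\<I> \<odot> Y)" and cX: "\<c> X \<I> \<in> hom C (X \<odot> \<I>) (\<I> \<odot> X)"
    using F unit_in by (simp_all add: symm_in)
  have lY: "\<lambda>I Y \<in> hom C (\<I> \<odot> Y) Y" and lX: "\<lambda>I X \<in> hom C (\<I> \<odot> X) X"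
    using F by (simp_all add: lunitor_in)
  have fI: "f \<otimes> idm \<I> \<in> hom C (X \<odot> \<I>) (Y \<odot> \<I>)" and If: "idm \<I> \<otimes> f \<in> hom C (\<I> \<odot> X) (\<I> \<odot> Y)"
    using F I by (auto intro: tensor_in)
  have "\<rho>I Y \<cdot> (f \<otimes> idm \<I>) = \<lambda>I Y \<cdot> (\<c> Y \<I> \<cdot> (f \<otimes> idm \<I>))"
    unfolding runitor_def by (rule comp_assoc[OF fI cY lY])
  also have "\<c> Y \<I> \<cdot> (f \<otimes> idm \<I>) = (idm \<I> \<otimes> f) \<cdot> \<c> X \<I>"
    using F I by (intro symm_natural) auto
  also have "\<lambda>I Y \<cdot> ((idm \<I> \<otimes> f) \<cdot> \<c> X \<I>) = (\<lambda>I Y \<cdot> (idm \<I> \<otimes> f)) \<cdot> \<c> X \<I>"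
    by (rule comp_assoc[OF cX If lY, symmetric])
  also have "\<lambda>I Y \<cdot> (idm \<I> \<otimes> f) = f \<cdot> \<lambda>I X"
    by (rule lunitor_natural_even[OF F(1,2)])
  also have "(f \<cdot> \<lambda>I X) \<cdot> \<c> X \<I> = f \<cdot> \<rho>I X"
    unfolding runitor_def by (rule comp_assoc[OF cX lX F(1)])
  finally show ?thesis .
qed

end

section \<open>Marginals of copies, and the two conditions equivalent to modularity\<close>

context quantum_cd_category
begin

lemma copy_even_hom: "X \<in> Obj C \<Longrightarrow> \<Delta> X \<in> even_hom C X (X \<odot> X)"
  by (simp add: even_hom_def copy_in copy_even)

lemma discard_even_hom: "X \<in> Obj C \<Longrightarrow> \<^bold>! X \<in> even_hom C X \<I>"
  by (simp add: even_hom_def discard_in discard_even)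

lemmas even_hom_intros =
  ident_even_hom comp_even_hom tensor_even_hom assoc_even_hom runitor_even_hom
  copy_even_hom discard_even_hom

text \<open>Discarding the second output commutes with \<open>h\<close> acting on the first;
  naturality of \<open>\<rho>I\<close> then brings \<open>h\<close> to the front, and the counit law
  cancels the copy against the discarding.\<close>

lemma copy_marginal:
  assumes h: "h \<in> even_hom C Y Z" and q: "q \<in> even_hom C T Y"
  shows "\<rho>I Z \<cdot> (idm Z \<otimes> \<^bold>! Y) \<cdot> (h \<otimes> idm Y) \<cdot> \<Delta> Y \<cdot> q = h \<cdot> q"
proof -
  note O = even_homD(4,5)[OF h]
  note t = even_hom_intros h q O unit_in
  have "\<rho>I Z \<cdot> (idm Z \<otimes> \<^bold>! Y) \<cdot> (h \<otimes> idm Y) \<cdot> \<Delta> Y \<cdot> q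
      = \<rho>I Z \<cdot> ((idm Z \<otimes> \<^bold>! Y) \<cdot> (h \<otimes> idm Y)) \<cdot> \<Delta> Y \<cdot> q"
    by (subst even_comp_assoc) (rule t refl)+
  also have "(idm Z \<otimes> \<^bold>! Y) \<cdot> (h \<otimes> idm Y) = (h \<otimes> idm \<I>) \<cdot> (idm Y \<otimes> \<^bold>! Y)"
    by (simp add: tensor_ident_slide[OF h discard_even_hom[OF O(1)]])
  also have "\<rho>I Z \<cdot> ((h \<otimes> idm \<I>) \<cdot> (idm Y \<otimes> \<^bold>! Y)) \<cdot> \<Delta> Y \<cdot> q
      = (\<rho>I Z \<cdot> (h \<otimes> idm \<I>)) \<cdot> ((idm Y \<otimes> \<^bold>! Y) \<cdot> \<Delta> Y) \<cdot> q"
    \<comment> \<open>Repeated substitution brings composites to right-nested form until both sides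
      agree; the rules \<open>t\<close> discharge the typing premises.\<close>
    by (subst even_comp_assoc, (rule t)+)+ (rule refl)
  also have "\<rho>I Z \<cdot> (h \<otimes> idm \<I>) = h \<cdot> \<rho>I Y"
    by (rule runitor_natural_even[OF h])
  also have "(h \<cdot> \<rho>I Y) \<cdot> ((idm Y \<otimes> \<^bold>! Y) \<cdot> \<Delta> Y) \<cdot> q
      = h \<cdot> (\<rho>I Y \<cdot> (idm Y \<otimes> \<^bold>! Y) \<cdot> \<Delta> Y) \<cdot> q"
    by (subst even_comp_assoc, (rule t)+)+ (rule refl)
  also have "\<dots> = h \<cdot> q"
    using even_homD(1)[OF q] by (simp add: copy_counit_right[OF O(1)] ident_comp)
  finally show ?thesis .
qed

text \<open>An almost-everywhere equation yields an honest one by taking the marginal of both sides.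
  It serves both to extract (a) from modularity and to obtain
  \<open>f \<cdot> g \<cdot> q = q\<close> from a disintegration.\<close>

lemma copy_marginal_cong:
  assumes "(h \<otimes> idm Y) \<cdot> \<Delta> Y \<cdot> q = (k \<otimes> idm Y) \<cdot> \<Delta> Y \<cdot> q"
    and "h \<in> even_hom C Y Z" "k \<in> even_hom C Y Z" "q \<in> even_hom C T Y"
  shows "h \<cdot> q = k \<cdot> q"
  using assms copy_marginal by metis

text \<open>Interchange merges the two outer factors on each side. The result has the shape required
  by \<open>copy_marginal_cong\<close>, with the compared morphisms going from \<open>Y\<close> to
  \<open>X \<odot> Y\<close>.\<close>

lemma left_ae_modular_eq:
  assumes q: "q \<in> even_hom C T Y" and g: "g \<in> even_hom C Y X" and f: "f \<in> even_hom C X Y"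
  shows "left_ae_modular C X Y f q g \<longleftrightarrow>
    (((idm X \<otimes> f) \<cdot> \<Delta> X \<cdot> g) \<otimes> idm Y) \<cdot> \<Delta> Y \<cdot> q
    = (((g \<otimes> idm Y) \<cdot> \<Delta> Y) \<otimes> idm Y) \<cdot> \<Delta> Y \<cdot> q"
proof -
  note O = even_homD(4,5)[OF g]
  note t = even_hom_intros q g f O
  have idY: "idm Y \<cdot> idm Y = idm Y"
    by (rule ident_comp[OF ident_in[OF O(1)]])
  have l: "((idm X \<otimes> f) \<otimes> idm Y) \<cdot> ((\<Delta> X \<cdot> g) \<otimes> idm Y) \<cdot> \<Delta> Y \<cdot> q
    = (((idm X \<otimes> f) \<cdot> \<Delta> X \<cdot> g) \<otimes> idm Y) \<cdot> \<Delta> Y \<cdot> q"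
    by (subst even_comp_assoc[symmetric], (rule t)+, subst interchange, (rule t)+)
      (simp add: idY)
  have r: "((g \<otimes> idm Y) \<otimes> idm Y) \<cdot> (\<Delta> Y \<otimes> idm Y) \<cdot> \<Delta> Y \<cdot> q
    = (((g \<otimes> idm Y) \<cdot> \<Delta> Y) \<otimes> idm Y) \<cdot> \<Delta> Y \<cdot> q"
    by (subst even_comp_assoc[symmetric], (rule t)+, subst interchange, (rule t)+)
      (simp add: idY)
  show ?thesis unfolding left_ae_modular_def l r ..
qed

lemma left_ae_modular_imp_Bayes:
  assumes q: "q \<in> even_hom C T Y" and g: "g \<in> even_hom C Y X" and f: "f \<in> even_hom C X Y"
    and m: "left_ae_modular C X Y f q g"
  shows "(g \<otimes> idm Y) \<cdot> \<Delta> Y \<cdot> q = (idm X \<otimes> f) \<cdot> \<Delta> X \<cdot> g \<cdot> q"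
proof -
  note O = even_homD(4,5)[OF g]
  note t = even_hom_intros q g f O
  have "((idm X \<otimes> f) \<cdot> \<Delta> X \<cdot> g) \<cdot> q = ((g \<otimes> idm Y) \<cdot> \<Delta> Y) \<cdot> q"
    by (rule copy_marginal_cong[OF m[unfolded left_ae_modular_eq[OF q g f]]]) (rule t)+
  moreover have "((idm X \<otimes> f) \<cdot> \<Delta> X \<cdot> g) \<cdot> q = (idm X \<otimes> f) \<cdot> \<Delta> X \<cdot> g \<cdot> q"
    by (subst even_comp_assoc, (rule t)+)+ (rule refl)
  moreover have "((g \<otimes> idm Y) \<cdot> \<Delta> Y) \<cdot> q = (g \<otimes> idm Y) \<cdot> \<Delta> Y \<cdot> q"
    by (rule even_comp_assoc) (rule t)+
  ultimately show ?thesis by simp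
qed

text \<open>Naturality moves the associator past the three morphisms to the double copy, where
  coassociativity absorbs it. It is applied at \<open>X\<close> with morphisms \<open>idm X\<close>,
  \<open>f\<close>, \<open>f\<close> and at \<open>Y\<close> with \<open>g\<close>,
  \<open>idm Y\<close>, \<open>idm Y\<close>.\<close>

lemma assoc_copy_left:
  assumes u: "u \<in> even_hom C X A" and v: "v \<in> even_hom C X B" and w: "w \<in> even_hom C X D"
    and p: "p \<in> even_hom C T X"
  shows "\<alpha> A B D \<cdot> ((u \<otimes> v) \<otimes> w) \<cdot> (\<Delta> X \<otimes> idm X) \<cdot> \<Delta> X \<cdot> p
    = (u \<otimes> (v \<otimes> w)) \<cdot> (idm X \<otimes> \<Delta> X) \<cdot> \<Delta> X \<cdot> p"
proof -
  note t = even_hom_intros u v w p even_homD(4)[OF u] even_homD(5)[OF u]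
    even_homD(5)[OF v] even_homD(5)[OF w]
  have "\<alpha> A B D \<cdot> ((u \<otimes> v) \<otimes> w) \<cdot> (\<Delta> X \<otimes> idm X) \<cdot> \<Delta> X \<cdot> p
      = (\<alpha> A B D \<cdot> ((u \<otimes> v) \<otimes> w)) \<cdot> (\<Delta> X \<otimes> idm X) \<cdot> \<Delta> X \<cdot> p"
    by (rule even_comp_assoc[symmetric]) (rule t)+
  also have "\<dots> = ((u \<otimes> (v \<otimes> w)) \<cdot> \<alpha> X X X) \<cdot> (\<Delta> X \<otimes> idm X) \<cdot> \<Delta> X \<cdot> p"
    by (simp only: even_assoc_natural[OF u v w])
  also have "\<dots> = (u \<otimes> (v \<otimes> w)) \<cdot> (\<alpha> X X X \<cdot> (\<Delta> X \<otimes> idm X) \<cdot> \<Delta> X) \<cdot> p"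
    by (subst even_comp_assoc, (rule t)+)+ (rule refl)
  also have "\<dots> = (u \<otimes> (v \<otimes> w)) \<cdot> ((idm X \<otimes> \<Delta> X) \<cdot> \<Delta> X) \<cdot> p"
    by (simp only: copy_coassoc[OF even_homD(4)[OF u]])
  also have "\<dots> = (u \<otimes> (v \<otimes> w)) \<cdot> (idm X \<otimes> \<Delta> X) \<cdot> \<Delta> X \<cdot> p"
    by (subst even_comp_assoc, (rule t)+)+ (rule refl)
  finally show ?thesis .
qed

text \<open>After the associator is applied, the left side of modularity becomes the left side of
  (b) and the right side the right side, each by one use of (a). Invertibility of the associator
  makes this an equivalence.\<close>

lemma left_ae_modular_iff_deterministic:
  assumes q: "q \<in> even_hom C T Y" and p: "p \<in> even_hom C T X"
    and g: "g \<in> even_hom C Y X" and f: "f \<in> even_hom C X Y"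
    and bayes: "(g \<otimes> idm Y) \<cdot> \<Delta> Y \<cdot> q = (idm X \<otimes> f) \<cdot> \<Delta> X \<cdot> p"
  shows "left_ae_modular C X Y f q g \<longleftrightarrow> right_ae_deterministic C X Y f p"
proof -
  note O = even_homD(4,5)[OF f]
  note t = even_hom_intros q p g f O
  note idX = ident_even_hom[OF O(1)] and idY = ident_even_hom[OF O(2)]
  note dX = copy_even_hom[OF O(1)] and dY = copy_even_hom[OF O(2)]
  define l where "l = ((idm X \<otimes> f) \<otimes> idm Y) \<cdot> ((\<Delta> X \<cdot> g) \<otimes> idm Y) \<cdot> \<Delta> Y \<cdot> q"
  define r where "r = ((g \<otimes> idm Y) \<otimes> idm Y) \<cdot> (\<Delta> Y \<otimes> idm Y) \<cdot> \<Delta> Y \<cdot> q"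
  have lr: "l \<in> even_hom C T ((X \<odot> Y) \<odot> Y)" "r \<in> even_hom C T ((X \<odot> Y) \<odot> Y)"
    unfolding l_def r_def by (rule t)+
  have cancel: "l = r \<longleftrightarrow> \<alpha> X Y Y \<cdot> l = \<alpha> X Y Y \<cdot> r"
    using is_iso_left_cancel[OF assoc_iso assoc_in] O lr even_homD(1) by metis
  \<comment> \<open>Splitting \<open>\<Delta> X \<cdot> g\<close> isolates the composite
    \<open>(g \<otimes> idm Y) \<cdot> \<Delta> Y \<cdot> q\<close>, which \<open>bayes\<close> can
    rewrite.\<close>
  have "l = ((idm X \<otimes> f) \<otimes> idm Y) \<cdot> (\<Delta> X \<otimes> idm Y) \<cdot> (g \<otimes> idm Y) \<cdot> \<Delta> Y \<cdot> q"
  proof -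
    have "(\<Delta> X \<cdot> g) \<otimes> idm Y = (\<Delta> X \<otimes> idm Y) \<cdot> (g \<otimes> idm Y)"
      by (simp add: interchange[OF dX idY g idY] ident_comp[OF even_homD(1)[OF idY]])
    then show ?thesis
      unfolding l_def by (simp only:) (subst even_comp_assoc, (rule t refl)+)
  qed
  also have "\<dots> = ((idm X \<otimes> f) \<otimes> idm Y) \<cdot> ((\<Delta> X \<otimes> idm Y) \<cdot> (idm X \<otimes> f)) \<cdot> \<Delta> X \<cdot> p"
    unfolding bayes by (subst even_comp_assoc, (rule t)+)+ (rule refl)
  \<comment> \<open>Copying the first factor commutes with \<open>f\<close> on the second, which
    brings the two copies at \<open>X\<close> next to each other.\<close>
  also have "(\<Delta> X \<otimes> idm Y) \<cdot> (idm X \<otimes> f) = ((idm X \<otimes> idm X) \<otimes> f) \<cdot> (\<Delta> X \<otimes> idm X)"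
    by (simp add: tensor_ident_slide[OF dX f] tensor_ident O)
  also have "((idm X \<otimes> f) \<otimes> idm Y) \<cdot> (((idm X \<otimes> idm X) \<otimes> f) \<cdot> (\<Delta> X \<otimes> idm X)) \<cdot> \<Delta> X \<cdot> p
      = (((idm X \<otimes> f) \<otimes> idm Y) \<cdot> ((idm X \<otimes> idm X) \<otimes> f)) \<cdot> (\<Delta> X \<otimes> idm X) \<cdot> \<Delta> X \<cdot> p"
    by (subst even_comp_assoc, (rule t)+)+ (rule refl)
  also have "((idm X \<otimes> f) \<otimes> idm Y) \<cdot> ((idm X \<otimes> idm X) \<otimes> f) = (idm X \<otimes> f) \<otimes> f"
    by (simp add: tensor_ident_slide(1)[OF tensor_even_hom[OF idX f] f] tensor_ident O)
  finally have "\<alpha> X Y Y \<cdot> l = (idm X \<otimes> (f \<otimes> f)) \<cdot> (idm X \<otimes> \<Delta> X) \<cdot> \<Delta> X \<cdot> p"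
    by (simp only: assoc_copy_left[OF idX f f p])
  moreover have "\<alpha> X Y Y \<cdot> r = (idm X \<otimes> (\<Delta> Y \<cdot> f)) \<cdot> \<Delta> X \<cdot> p"
  proof -
    have "\<alpha> X Y Y \<cdot> r = (g \<otimes> (idm Y \<otimes> idm Y)) \<cdot> (idm Y \<otimes> \<Delta> Y) \<cdot> \<Delta> Y \<cdot> q"
      unfolding r_def by (rule assoc_copy_left[OF g idY idY q])
    also have "\<dots> = ((g \<otimes> (idm Y \<otimes> idm Y)) \<cdot> (idm Y \<otimes> \<Delta> Y)) \<cdot> \<Delta> Y \<cdot> q"
      by (rule even_comp_assoc[symmetric]) (rule t)+
    \<comment> \<open>Both sides equal \<open>g \<otimes> \<Delta> Y\<close>. Moving
      \<open>g\<close> to the right exposes the left side of (a), now used with the copy still to be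
      applied to its second output.\<close>
    also have "(g \<otimes> (idm Y \<otimes> idm Y)) \<cdot> (idm Y \<otimes> \<Delta> Y) = (idm X \<otimes> \<Delta> Y) \<cdot> (g \<otimes> idm Y)"
      by (simp add: tensor_ident_slide[OF g dY] tensor_ident O)
    also have "((idm X \<otimes> \<Delta> Y) \<cdot> (g \<otimes> idm Y)) \<cdot> \<Delta> Y \<cdot> q
        = (idm X \<otimes> \<Delta> Y) \<cdot> (idm X \<otimes> f) \<cdot> \<Delta> X \<cdot> p"
      unfolding bayes[symmetric] by (rule even_comp_assoc) (rule t)+
    also have "\<dots> = ((idm X \<otimes> \<Delta> Y) \<cdot> (idm X \<otimes> f)) \<cdot> \<Delta> X \<cdot> p"
      by (rule even_comp_assoc[symmetric]) (rule t)+
    also have "(idm X \<otimes> \<Delta> Y) \<cdot> (idm X \<otimes> f) = idm X \<otimes> (\<Delta> Y \<cdot> f)"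
      by (simp add: interchange[OF idX dY idX f] ident_comp[OF even_homD(1)[OF idX]])
    finally show ?thesis .
  qed
  ultimately show ?thesis
    using cancel unfolding left_ae_modular_def right_ae_deterministic_def l_def r_def by simp
qed

text \<open>Modularity first gives (a), and (a) is exactly what licenses exchanging modularity for
  (b). Here \<open>p\<close> is instantiated to \<open>g \<cdot> q\<close>.\<close>

lemma left_ae_modular_iff:
  assumes q: "q \<in> even_hom C T Y" and g: "g \<in> even_hom C Y X" and f: "f \<in> even_hom C X Y"
  shows "left_ae_modular C X Y f q g \<longleftrightarrow>
    (g \<otimes> idm Y) \<cdot> \<Delta> Y \<cdot> q = (idm X \<otimes> f) \<cdot> \<Delta> X \<cdot> g \<cdot> q \<and>
    right_ae_deterministic C X Y f (g \<cdot> q)"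
  using left_ae_modular_imp_Bayes[OF assms]
    left_ae_modular_iff_deterministic[OF q comp_even_hom[OF g q] g f] by blast

text \<open>Comparing marginals with those of the identity gives the result. It supplies the
  equation \<open>f \<cdot> p = q\<close> built into \<open>left_disintegration\<close>, which the
  definition of a modular subcategory does not state.\<close>

lemma disintegration_section:
  assumes q: "q \<in> even_hom C T Y" and g: "g \<in> even_hom C Y X" and f: "f \<in> even_hom C X Y"
    and d: "((f \<cdot> g) \<otimes> idm Y) \<cdot> \<Delta> Y \<cdot> q = \<Delta> Y \<cdot> q"
  shows "f \<cdot> g \<cdot> q = q"
proof -
  note O = even_homD(4,5)[OF g]
  note t = even_hom_intros q g f O
  have "\<Delta> Y \<cdot> q \<in> even_hom C T (Y \<odot> Y)" by (rule t)+
  \<comment> \<open>The identity is inserted so that the right side also has the form expected by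
    \<open>copy_marginal_cong\<close>, with \<open>k = idm Y\<close>.\<close>
  then have "(idm Y \<otimes> idm Y) \<cdot> \<Delta> Y \<cdot> q = \<Delta> Y \<cdot> q"
    using even_homD(1) ident_comp by (fastforce simp: tensor_ident O)
  then have "((f \<cdot> g) \<otimes> idm Y) \<cdot> \<Delta> Y \<cdot> q = (idm Y \<otimes> idm Y) \<cdot> \<Delta> Y \<cdot> q"
    using d by simp
  then have "(f \<cdot> g) \<cdot> q = idm Y \<cdot> q"
    by (rule copy_marginal_cong) (rule t)+
  then show ?thesis
    using even_comp_assoc[OF f g q] ident_comp[OF even_homD(1)[OF q]] by simp
qed

text \<open>A disintegration forces \<open>p = g \<cdot> q\<close>; conversely, this choice of
  \<open>p\<close> turns data satisfying the almost-everywhere equation into a disintegration.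
  Either way \<open>left_ae_modular_iff\<close> applies.\<close>

lemma left_ae_modular_subcategory_iff:
  assumes S: "even_subcategory C U S"
  shows "left_ae_modular_subcategory C S \<longleftrightarrow>
    (\<forall>\<Theta> X Y f p q g. left_disintegration C S \<Theta> X Y f p q g \<longrightarrow>
      left_Bayesian_inverse C S \<Theta> X Y f p q g \<and> right_ae_deterministic C X Y f p)"
    (is "?M \<longleftrightarrow> ?D")
proof
  have even: "h \<in> even_hom C A B" if "h \<in> S \<inter> hom C A B" for h A B
    using S that by (simp add: even_subcategory_def even_hom_def)
  show ?D if ?M
  proof (intro allI impI)
    fix \<Theta> X Y f p q g
    assume d: "left_disintegration C S \<Theta> X Y f p q g"
    then have m: "f \<in> S \<inter> hom C X Y" "g \<in> S \<inter> hom C Y X" "q \<in> S \<inter> hom C \<Theta> Y"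
      and p: "p = g \<cdot> q" and e: "((f \<cdot> g) \<otimes> idm Y) \<cdot> \<Delta> Y \<cdot> q = \<Delta> Y \<cdot> q"
      by (simp_all add: left_disintegration_def triple_in_def)
    have "left_ae_modular C X Y f q g"
      using \<open>?M\<close> m e unfolding left_ae_modular_subcategory_def by blast
    then show "left_Bayesian_inverse C S \<Theta> X Y f p q g \<and> right_ae_deterministic C X Y f p"
      using d unfolding left_ae_modular_iff[OF even[OF m(3)] even[OF m(2)] even[OF m(1)]]
      by (simp add: left_Bayesian_inverse_def left_disintegration_def p)
  qed
  show ?M if ?D
    unfolding left_ae_modular_subcategory_def
  proof (intro allI impI)
    fix \<Theta> X Y f g q
    assume m: "f \<in> S \<inter> hom C X Y" "g \<in> S \<inter> hom C Y X" "q \<in> S \<inter> hom C \<Theta> Y"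
      and e: "((f \<cdot> g) \<otimes> idm Y) \<cdot> \<Delta> Y \<cdot> q = \<Delta> Y \<cdot> q"
    note E = even[OF m(3)] even[OF m(2)] even[OF m(1)]
    \<comment> \<open>Closure of the subcategory under composition makes \<open>g \<cdot> q\<close>
      an admissible \<open>p\<close>.\<close>
    have "g \<cdot> q \<in> S"
      using S m by (simp add: even_subcategory_def hom_def)
    then have "left_disintegration C S \<Theta> X Y f (g \<cdot> q) q g"
      using m e disintegration_section[OF E e] comp_in[of q \<Theta> Y g X]
      by (simp add: left_disintegration_def triple_in_def)
    then show "left_ae_modular C X Y f q g"
      using \<open>?D\<close> unfolding left_ae_modular_iff[OF E]
      by (auto simp: left_Bayesian_inverse_def)
  qed
qed

end

theorem theorem8p3:
  fixes C :: "('o, 'a, 'm) qcd_cat_scheme" (structure)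
  assumes "quantum_markov_category C"
  shows
    "(\<forall>\<Theta> X Y q g f p.
        q \<in> hom C \<Theta> Y \<longrightarrow> is_even C q \<longrightarrow>
        g \<in> hom C Y X \<longrightarrow> is_even C g \<longrightarrow>
        f \<in> hom C X Y \<longrightarrow> is_even C f \<longrightarrow>
        p = g \<cdot> q \<longrightarrow>
        ((f \<cdot> g) \<otimes> idm Y) \<cdot> \<Delta> Y \<cdot> q = \<Delta> Y \<cdot> q \<longrightarrow>
        (((idm X \<otimes> f) \<otimes> idm Y) \<cdot> ((\<Delta> X \<cdot> g) \<otimes> idm Y) \<cdot> \<Delta> Y \<cdot> q
           = ((g \<otimes> idm Y) \<otimes> idm Y) \<cdot> (\<Delta> Y \<otimes> idm Y) \<cdot> \<Delta> Y \<cdot> q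
         \<longleftrightarrow>
         (g \<otimes> idm Y) \<cdot> \<Delta> Y \<cdot> q = (idm X \<otimes> f) \<cdot> \<Delta> X \<cdot> p \<and>
         (idm X \<otimes> (f \<otimes> f)) \<cdot> (idm X \<otimes> \<Delta> X) \<cdot> \<Delta> X \<cdot> p
           = (idm X \<otimes> (\<Delta> Y \<cdot> f)) \<cdot> \<Delta> X \<cdot> p))
     \<and>
     (\<forall>U S. even_subcategory C U S \<longrightarrow>
        (left_ae_modular_subcategory C S \<longleftrightarrow>
         (\<forall>\<Theta> X Y f p q g. left_disintegration C S \<Theta> X Y f p q g \<longrightarrow>
            left_Bayesian_inverse C S \<Theta> X Y f p q g \<and> right_ae_deterministic C X Y f p)))"
proof -
  interpret quantum_markov_category C by fact
  show ?thesis
    \<comment> \<open>For the first half, unfolding the two predicates gives the displayed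
      equations, and \<open>p\<close> is eliminated through \<open>p = g \<cdot> q\<close>.\<close>
    using left_ae_modular_iff left_ae_modular_subcategory_iff
    unfolding left_ae_modular_def right_ae_deterministic_def
    by (auto simp: even_hom_def)
qed

end
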